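(* Any deterministic strategyproof mechanism which always outputs the facility at an agent location has an approximation ratio of at least $2$ for minimizing the social cost when locations are public and group memberships are private. That is, for every $\rho<2$ there is no deterministic mechanism that always outputs an element of $\{x_1,\dots,x_n\}$, is strategyproof when locations are public and group memberships are private, and has approximation ratio $\rho$ for the social cost.
   Context: Setting. $N=\{1,\dots,n\}$ is a set of agents, $I=[0,1]$, $[m]=\{1,\dots,m\}$ indexes groups. Agent $i$ has a profile $r_i=(x_i,g_i)$ with location $x_i\in I$ and group $g_i\in[m]$; $\mathbf r=(r_1,\dots,r_n)$. $G_j=\{i\in N: g_i=j\}$. $d(a,b)=|a-b|$. Each group $j$ has a known externality factor $\alpha_j\ge 0$. If the facility is at $y\in I$, the cost of agent $i$ is $$c_i(y,\mathbf r)=d(y,x_i)+\alpha_{g_i}\sum_{k\in G_{g_i}\setminus\{i\}}(1-d(y,x_k)).$$ Standing assumption on (true) profiles: $\alpha_j\le 1/(|G_j|-1)$ for each group $j$ (void if $|G_j|\le 1$). Social cost: $\mathrm{SC}(y,\mathbf r)=\sum_{i\in N}c_i(y,\mathbf r)$. A deterministic mechanism $f$ assigns, for every $n$, $m$ and $(\alpha_j)_{j\in[m]}$, a facility location $f(\mathbf r)\in I$ to each profile $\mathbf r$. Strategyproof when locations are public and group memberships are private: for every true profile $\mathbf r$, every reported profile $\mathbf r'$ with the same locations ($x'_k=x_k$ for all $k$) and every agent $i$, $c_i(f(r_i,\mathbf r'_{-i}),\mathbf r)\le c_i(f(\mathbf r'),\mathbf r)$, where $\mathbf r'_{-i}$ are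 the reports of all agents other than $i$. $f$ has approximation ratio $\rho$ for the social cost if for all $n,m,(\alpha_j)$ and all profiles $\mathbf r$ satisfying the standing assumption, $\mathrm{SC}(f(\mathbf r),\mathbf r)\le\rho\min_{z\in I}\mathrm{SC}(z,\mathbf r)$. *)

theory Defs
  imports "HOL-Analysis.Analysis"
begin

text \<open>
  Agents are \<open>{1..n}\<close>, groups are \<open>{1..m}\<close>, and the profile of agent \<open>i\<close> is the pair
  \<open>r i = (x\<^sub>i, g\<^sub>i)\<close>. Profiles and externality factors are extensional functions, so that a
  mechanism cannot depend on values outside the index sets \<open>{1..n}\<close> and \<open>{1..m}\<close>.
\<close>

type_synonym profile = "nat \<Rightarrow> real \<times> nat"

definition location :: "profile \<Rightarrow> nat \<Rightarrow> real" where
  "location r i = fst (r i)"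

definition group :: "profile \<Rightarrow> nat \<Rightarrow> nat" where
  "group r i = snd (r i)"

definition members :: "nat \<Rightarrow> profile \<Rightarrow> nat \<Rightarrow> nat set" where
  "members n r j = {i \<in> {1..n}. group r i = j}"

definition factors :: "nat \<Rightarrow> (nat \<Rightarrow> real) set" where
  "factors m = ({1..m} \<rightarrow>\<^sub>E {0..})"

definition profiles :: "nat \<Rightarrow> nat \<Rightarrow> profile set" where
  "profiles n m = ({1..n} \<rightarrow>\<^sub>E {0..1} \<times> {1..m})"

text \<open>Only true profiles have to be admissible; reported profiles are arbitrary.\<close>

definition admissible_profiles :: "nat \<Rightarrow> nat \<Rightarrow> (nat \<Rightarrow> real) \<Rightarrow> profile set" where
  "admissible_profiles n m \<alpha> =
     {r \<in> profiles n m. \<forall>j\<in>{1..m}. card (members n r j) > 1 \<longrightarrow>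
        \<alpha> j \<le> 1 / (real (card (members n r j)) - 1)}"

definition cost :: "nat \<Rightarrow> (nat \<Rightarrow> real) \<Rightarrow> profile \<Rightarrow> real \<Rightarrow> nat \<Rightarrow> real" where
  "cost n \<alpha> r y i = dist y (location r i) +
     \<alpha> (group r i) * (\<Sum>k\<in>members n r (group r i) - {i}. 1 - dist y (location r k))"

definition social_cost :: "nat \<Rightarrow> (nat \<Rightarrow> real) \<Rightarrow> profile \<Rightarrow> real \<Rightarrow> real" where
  "social_cost n \<alpha> r y = (\<Sum>i\<in>{1..n}. cost n \<alpha> r y i)"

definition min_social_cost :: "nat \<Rightarrow> (nat \<Rightarrow> real) \<Rightarrow> profile \<Rightarrow> real" where
  "min_social_cost n \<alpha> r = (INF z\<in>{0..1}. social_cost n \<alpha> r z)"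

text \<open>The infimum is a minimum:\<close>

lemma min_social_cost_attained:
  "\<exists>z\<in>{0..1}. min_social_cost n \<alpha> r = social_cost n \<alpha> r z
     \<and> (\<forall>y\<in>{0..1}. social_cost n \<alpha> r z \<le> social_cost n \<alpha> r y)"
proof -
  have "continuous_on {0..1} (social_cost n \<alpha> r)"
    unfolding social_cost_def cost_def by (intro continuous_intros)
  then obtain z where z: "z \<in> {0..1}"
      "\<forall>y\<in>{0..1}. social_cost n \<alpha> r z \<le> social_cost n \<alpha> r y"
    using continuous_attains_inf[of "{0..1::real}" "social_cost n \<alpha> r"] by auto
  then have "min_social_cost n \<alpha> r = social_cost n \<alpha> r z"
    unfolding min_social_cost_def by (intro cInf_eq_minimum) auto
  with z show ?thesis by blast
qed

text \<open>
  A candidate mechanism is applied as \<open>f n m \<alpha> r\<close>. There is at least one agent throughout: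
  for \<open>n = 0\<close> no output could be an agent location.
\<close>

type_synonym mechanism = "nat \<Rightarrow> nat \<Rightarrow> (nat \<Rightarrow> real) \<Rightarrow> profile \<Rightarrow> real"

definition deterministic_mechanism :: "mechanism \<Rightarrow> bool" where
  "deterministic_mechanism f \<longleftrightarrow>
     (\<forall>n\<ge>1. \<forall>m. \<forall>\<alpha>\<in>factors m. \<forall>r\<in>profiles n m. f n m \<alpha> r \<in> {0..1})"

definition outputs_agent_location :: "mechanism \<Rightarrow> bool" where
  "outputs_agent_location f \<longleftrightarrow>
     (\<forall>n\<ge>1. \<forall>m. \<forall>\<alpha>\<in>factors m. \<forall>r\<in>profiles n m. f n m \<alpha> r \<in> location r ` {1..n})"

text \<open>
  Below, \<open>r\<close> is the true and \<open>r'\<close> the reported profile; \<open>r'(i := r i)\<close> is the report in which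
  agent \<open>i\<close> switches to the truth.
\<close>

definition strategyproof_public_locations_private_groups :: "mechanism \<Rightarrow> bool" where
  "strategyproof_public_locations_private_groups f \<longleftrightarrow>
     (\<forall>n\<ge>1. \<forall>m. \<forall>\<alpha>\<in>factors m. \<forall>r\<in>admissible_profiles n m \<alpha>. \<forall>r'\<in>profiles n m.
        (\<forall>k\<in>{1..n}. location r' k = location r k) \<longrightarrow>
        (\<forall>i\<in>{1..n}. cost n \<alpha> r (f n m \<alpha> (r'(i := r i))) i \<le> cost n \<alpha> r (f n m \<alpha> r') i))"

definition has_approximation_ratio :: "mechanism \<Rightarrow> real \<Rightarrow> bool" where
  "has_approximation_ratio f \<rho> \<longleftrightarrow>
     (\<forall>n\<ge>1. \<forall>m. \<forall>\<alpha>\<in>factors m. \<forall>r\<in>admissible_profiles n m \<alpha>.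
        social_cost n \<alpha> r (f n m \<alpha> r) \<le> \<rho> * min_social_cost n \<alpha> r)"

end

theory Submission
  imports Defs
begin

text \<open>
  If some group has factor \<open>0\<close>, an agent may believe that everybody else belongs to that group, and
  then it only cares about its distance to the facility, whatever its own group is. So strategyproofness
  makes this distance independent of its report; when all locations are \<open>0\<close> or \<open>1\<close> the
  output therefore depends on the locations only. Now put two agents at \<open>0\<close> and two at \<open>1\<close>.
  If one pair forms a group with factor \<open>1\<close>, its total cost is constantly \<open>2\<close>, while the
  other pair, with factor \<open>0\<close>, contributes twice its distance to the facility. The optimum is thus
  \<open>2\<close>, attained at the pair with factor \<open>0\<close>, and the other agent location costs \<open>4\<close>.
  Either pair can be the one with factor \<open>1\<close>, so a common output is bad for one of the two.
\<close>

text \<open>Strategyproofness leaves the reports of the other agents arbitrary, so \<open>r\<close>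
  can be the report while the truth is a profile \<open>t\<close> in which the cost of agent
  \<open>i\<close> is its distance to the facility alone.\<close>

lemma dist_le_of_report:
  assumes sp: "strategyproof_public_locations_private_groups f"
    and \<alpha>: "\<alpha> \<in> factors m" "j \<in> {1..m}" "\<alpha> j = 0"
    and r: "r \<in> profiles n m" and i: "i \<in> {1..n}" and h: "h \<in> {1..m}"
  shows "dist (f n m \<alpha> (r(i := (location r i, h)))) (location r i)
           \<le> dist (f n m \<alpha> r) (location r i)"
proof -
  define t :: profile where
    "t = (\<lambda>k\<in>{1..n}. (location r k, if k = i then h else j))"
  have loc: "location t k = location r k" if "k \<in> {1..n}" for k
    using that by (simp add: t_def location_def)
  have t_i: "t i = (location r i, h)"
    using i by (simp add: t_def)
  have "t \<in> profiles n m"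
    using r h \<alpha>(2) by (auto simp: t_def profiles_def location_def PiE_iff mem_Times_iff)
  moreover have "members n t k \<subseteq> {i}" if "k \<noteq> j" for k
    using that by (auto simp: members_def t_def group_def split: if_splits)
  then have "card (members n t k) \<le> 1" if "k \<noteq> j" for k
    using that card_mono[of "{i}" "members n t k"] by simp
  \<comment> \<open>Only group \<open>j\<close> can have more than one member in \<open>t\<close>,
    and its factor is 0, so \<open>t\<close> meets the standing assumption.\<close>
  then have "\<alpha> k \<le> 1 / (real (card (members n t k)) - 1)"
    if "card (members n t k) > 1" for k
    using that \<alpha>(3) by (cases "k = j") (auto simp: not_less[symmetric])
  ultimately have adm: "t \<in> admissible_profiles n m \<alpha>"
    by (simp add: admissible_profiles_def)
  have cost: "cost n \<alpha> t y i = dist y (location r i)" for y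
  proof (cases "h = j")
    case True
    then show ?thesis
      using \<alpha>(3) i loc by (simp add: cost_def group_def t_i)
  next
    case False
    \<comment> \<open>Outside group \<open>j\<close>, agent \<open>i\<close> is alone in its group
      and has no externality term.\<close>
    then have "members n t h - {i} = {}"
      by (auto simp: members_def t_def group_def split: if_splits)
    then have "(\<Sum>k\<in>members n t h - {i}. 1 - dist y (location t k)) = 0"
      by (simp only: sum.empty)
    then show ?thesis
      using i loc by (simp add: cost_def group_def t_i)
  qed
  have "n \<ge> 1"
    using i by simp
  then have "cost n \<alpha> t (f n m \<alpha> (r(i := t i))) i \<le> cost n \<alpha> t (f n m \<alpha> r) i"
    using sp \<alpha>(1) adm r i loc
    unfolding strategyproof_public_locations_private_groups_def by metis
  then show ?thesis
    by (simp add: cost t_i)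
qed

text \<open>Undoing a change of report is again a change of report, so the inequality holds in both
  directions.\<close>

lemma dist_independent_of_report:
  assumes "strategyproof_public_locations_private_groups f"
    and "\<alpha> \<in> factors m" "j \<in> {1..m}" "\<alpha> j = 0"
    and r: "r \<in> profiles n m" and i: "i \<in> {1..n}" and h: "h \<in> {1..m}"
  shows "dist (f n m \<alpha> (r(i := (location r i, h)))) (location r i)
           = dist (f n m \<alpha> r) (location r i)"
proof (rule antisym)
  let ?s = "r(i := (location r i, h))"
  have "r i \<in> {0..1} \<times> {1..m}"
    using r i unfolding profiles_def by (rule PiE_mem)
  then have s: "?s \<in> profiles n m" and g: "group r i \<in> {1..m}"
    using r i h by (auto simp: profiles_def location_def group_def PiE_iff extensional_def mem_Times_iff)
  have "?s(i := (location ?s i, group r i)) = r" "location ?s i = location r i"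
    by (auto simp: location_def group_def)
  with dist_le_of_report[OF assms(1-4) s i g]
  show "dist (f n m \<alpha> r) (location r i) \<le> dist (f n m \<alpha> ?s) (location r i)"
    by simp
qed (rule dist_le_of_report[OF assms])

lemma output_independent_of_groups:
  assumes sp: "strategyproof_public_locations_private_groups f"
    and out: "outputs_agent_location f"
    and \<alpha>: "\<alpha> \<in> factors m" "j \<in> {1..m}" "\<alpha> j = 0"
    and r: "r \<in> profiles n m" and s: "s \<in> profiles n m" and n: "n \<ge> 1"
    and loc: "\<And>i. i \<in> {1..n} \<Longrightarrow> location s i = location r i"
    and two: "\<And>i. i \<in> {1..n} \<Longrightarrow> location r i \<in> {0, 1}"
  shows "f n m \<alpha> s = f n m \<alpha> r"
proof -
  \<comment> \<open>Hybrid profiles lead from \<open>r\<close> to \<open>s\<close>, one agent at a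
    time. Index 0 is not an agent; there \<open>r\<close> and \<open>s\<close> agree by
    extensionality, so \<open>p 0 = r\<close>.\<close>
  define p where "p k = (\<lambda>i. if i \<le> k then s i else r i)" for k :: nat
  have p: "p k \<in> profiles n m" for k
    using r s by (auto simp: p_def profiles_def PiE_iff extensional_def)
  have loc_p: "location (p k) i = location r i" if "i \<in> {1..n}" for k i
    using loc[OF that] by (simp add: p_def location_def)
  have f01: "f n m \<alpha> (p k) \<in> {0, 1}" for k
  proof -
    have "f n m \<alpha> (p k) \<in> location (p k) ` {1..n}"
      using out n \<alpha>(1) p unfolding outputs_agent_location_def by blast
    then obtain i where "i \<in> {1..n}" "f n m \<alpha> (p k) = location (p k) i"
      by blast
    then show ?thesis
      using two loc_p by metis
  qed
  have "f n m \<alpha> (p k) = f n m \<alpha> (p 0)" if "k \<le> n" for k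
    using that
  proof (induction k)
    case (Suc k)
    let ?i = "Suc k"
    have i: "?i \<in> {1..n}"
      using Suc.prems by simp
    have "s ?i \<in> {0..1} \<times> {1..m}"
      using s i unfolding profiles_def by (rule PiE_mem)
    then have g: "group s ?i \<in> {1..m}"
      by (auto simp: group_def)
    have "s ?i = (location (p k) ?i, group s ?i)"
      using loc[OF i] loc_p[OF i] by (simp add: location_def group_def prod_eq_iff)
    then have "p ?i = (p k)(?i := (location (p k) ?i, group s ?i))"
      by (auto simp: p_def fun_eq_iff le_Suc_eq)
    then have "dist (f n m \<alpha> (p ?i)) (location r ?i) = dist (f n m \<alpha> (p k)) (location r ?i)"
      using dist_independent_of_report[OF sp \<alpha> p i g, of k] loc_p[OF i] by simp
    \<comment> \<open>A point of {0, 1} is determined by its distance to either endpoint.\<close>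
    then have "f n m \<alpha> (p ?i) = f n m \<alpha> (p k)"
      using f01[of k] f01[of ?i] two[OF i] by (auto simp: dist_real_def)
    then show ?case
      using Suc by simp
  qed simp
  from this[of n] have "f n m \<alpha> (p n) = f n m \<alpha> (p 0)"
    by simp
  moreover have "p n = s" "p 0 = r"
    using r s by (auto simp: p_def fun_eq_iff profiles_def PiE_iff extensional_def)
  ultimately show ?thesis
    by simp
qed

text \<open>Group 1 supplies the zero factor that the independence of reports relies on; 1 is the
  largest factor admissible for a pair.\<close>

definition two_factors :: "nat \<Rightarrow> real" where
  "two_factors = (\<lambda>j\<in>{1..2}. if j = 1 then 0 else 1)"

text \<open>\<open>S\<close> is the group with factor 1; varying it leaves the locations
  fixed.\<close>

definition two_pairs :: "nat set \<Rightarrow> profile" where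
  "two_pairs S = (\<lambda>i\<in>{1..4}. (if i \<le> 2 then 0 else 1, if i \<in> S then 2 else 1))"

lemma two_factors_in_factors: "two_factors \<in> factors 2"
  by (auto simp: two_factors_def factors_def)

lemma two_pairs_in_profiles: "two_pairs S \<in> profiles 4 2"
  by (auto simp: two_pairs_def profiles_def)

lemma location_two_pairs: "i \<in> {1..4} \<Longrightarrow> location (two_pairs S) i = (if i \<le> 2 then 0 else 1)"
  by (simp add: location_def two_pairs_def)

lemma group_two_pairs: "i \<in> {1..4} \<Longrightarrow> group (two_pairs S) i = (if i \<in> S then 2 else 1)"
  by (simp add: group_def two_pairs_def)

lemma members_two_pairs:
  assumes "S \<subseteq> {1..4}"
  shows "members 4 (two_pairs S) 2 = S"
  using assms by (auto simp: members_def group_two_pairs split: if_splits)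

lemma two_pairs_admissible:
  assumes "S \<subseteq> {1..4}" "card S = 2"
  shows "two_pairs S \<in> admissible_profiles 4 2 two_factors"
proof -
  have "{1..2} = {1, 2::nat}"
    by auto
  then show ?thesis
    using assms two_pairs_in_profiles
    by (simp add: admissible_profiles_def members_two_pairs two_factors_def)
qed

lemma social_cost_two_pairs:
  assumes "S \<subseteq> {1..4}"
  shows "social_cost 4 two_factors (two_pairs S) y =
    (\<Sum>i\<in>{1..4}. dist y (if i \<le> 2 then 0 else 1)
       + (if i \<in> S then \<Sum>k\<in>S - {i}. 1 - dist y (if k \<le> 2 then 0 else 1) else 0))"
  unfolding social_cost_def cost_def
proof (rule sum.cong[OF refl])
  fix i :: nat
  assume i: "i \<in> {1..4}"
  have "(\<Sum>k\<in>S - {i}. 1 - dist y (location (two_pairs S) k))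
      = (\<Sum>k\<in>S - {i}. 1 - dist y (if k \<le> 2 then 0 else 1))"
    using assms by (intro sum.cong) (auto simp: location_two_pairs)
  then show "dist y (location (two_pairs S) i) + two_factors (group (two_pairs S) i) *
        (\<Sum>k\<in>members 4 (two_pairs S) (group (two_pairs S) i) - {i}.
           1 - dist y (location (two_pairs S) k))
      = dist y (if i \<le> 2 then 0 else 1)
        + (if i \<in> S then \<Sum>k\<in>S - {i}. 1 - dist y (if k \<le> 2 then 0 else 1) else 0)"
    using i members_two_pairs[OF assms]
    by (simp add: location_two_pairs group_two_pairs two_factors_def)
qed

lemma atLeastAtMost_1_4: "{1..4::nat} = {1, 2, 3, 4}"
  by auto

text \<open>Each agent at 0 pays \<open>y + (1 - y) = 1\<close>, and each agent at 1 pays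
  \<open>1 - y\<close>.\<close>

lemma social_cost_pair_at_0:
  "y \<in> {0..1} \<Longrightarrow> social_cost 4 two_factors (two_pairs {1, 2}) y = 4 - 2 * y"
  by (subst social_cost_two_pairs) (auto simp: atLeastAtMost_1_4 dist_real_def insert_Diff_if simp del: One_nat_def)

lemma social_cost_pair_at_1:
  "y \<in> {0..1} \<Longrightarrow> social_cost 4 two_factors (two_pairs {3, 4}) y = 2 + 2 * y"
  by (subst social_cost_two_pairs) (auto simp: atLeastAtMost_1_4 dist_real_def insert_Diff_if simp del: One_nat_def)

lemma min_social_cost_eqI:
  assumes "z \<in> {0..1}" "\<And>y. y \<in> {0..1} \<Longrightarrow> social_cost n \<alpha> r z \<le> social_cost n \<alpha> r y"
  shows "min_social_cost n \<alpha> r = social_cost n \<alpha> r z"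
  unfolding min_social_cost_def using assms by (intro cInf_eq_minimum) auto

theorem theorem3:
  fixes \<rho> :: real
  assumes "\<rho> < 2"
  shows "\<not> (\<exists>f :: mechanism.
            deterministic_mechanism f
          \<and> outputs_agent_location f
          \<and> strategyproof_public_locations_private_groups f
          \<and> has_approximation_ratio f \<rho>)"
proof
  assume "\<exists>f :: mechanism.
            deterministic_mechanism f
          \<and> outputs_agent_location f
          \<and> strategyproof_public_locations_private_groups f
          \<and> has_approximation_ratio f \<rho>"
  then obtain f :: mechanism
    where out: "outputs_agent_location f"
      and sp: "strategyproof_public_locations_private_groups f"
      and ratio: "has_approximation_ratio f \<rho>"
    by blast
  let ?f = "\<lambda>S. f 4 2 two_factors (two_pairs S)"
  \<comment> \<open>The 1 instantiates \<open>j\<close>, the group with factor 0.\<close>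
  have "?f {3, 4} = ?f {1, 2}"
    by (rule output_independent_of_groups[OF sp out two_factors_in_factors, of 1])
      (auto simp: two_factors_def two_pairs_in_profiles location_two_pairs)
  moreover have bound: "social_cost 4 two_factors (two_pairs S) (?f S)
      \<le> \<rho> * min_social_cost 4 two_factors (two_pairs S)"
    if "S \<subseteq> {1..4}" "card S = 2" for S
    using ratio two_factors_in_factors two_pairs_admissible[OF that]
    unfolding has_approximation_ratio_def by simp
  have "?f {1, 2} \<in> location (two_pairs {1, 2}) ` {1..4}"
    using out two_factors_in_factors two_pairs_in_profiles[of "{1, 2}"]
    unfolding outputs_agent_location_def by simp
  then have "?f {1, 2} = 0 \<or> ?f {1, 2} = 1"
    by (auto simp: location_two_pairs split: if_splits)
  moreover have "min_social_cost 4 two_factors (two_pairs {1, 2}) = 2"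
    by (subst min_social_cost_eqI[of 1]) (auto simp: social_cost_pair_at_0 simp del: One_nat_def)
  \<comment> \<open>Output 0 would cost 4, while the bound is \<open>\<rho> * 2 < 4\<close>.\<close>
  then have "?f {1, 2} \<noteq> 0"
    using bound[of "{1, 2}"] assms by (auto simp: social_cost_pair_at_0 simp del: One_nat_def)
  moreover have "min_social_cost 4 two_factors (two_pairs {3, 4}) = 2"
    by (subst min_social_cost_eqI[of 0]) (auto simp: social_cost_pair_at_1)
  then have "?f {3, 4} \<noteq> 1"
    using bound[of "{3, 4}"] assms by (auto simp: social_cost_pair_at_1)
  ultimately show False
    by auto
qed

end
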